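(* Let $q$ be a power of a prime $p$, let $D$ be an additive subgroup of $\mathbb{F}_q$ with $|D|=n$, let $k,r\ge 0$ be integers and $\gamma\in\mathbb{F}_q$. Then $$N(x^{k+1}+\gamma x^k,r)=q^{k-r}\binom{n}{r}\sum_{j=0}^{k-r}(-q)^{-j}\binom{n-r}{j}+\frac{\mathbf{1}[\gamma\in D]}{n}(-1)^{k+1-r}\binom{n}{r}\binom{n-r}{k+1-r}$$ $$+\frac{\mathbf{1}[p\mid(k+1),\ \gamma\in D]}{n}\big(n\,\mathbf{1}[\gamma=0]-1\big)(-1)^{r+(k+1)/p}\binom{k+1}{r}\binom{n/p}{(k+1)/p}.$$
   Context: $N(x^{k+1}+\gamma x^k,r)$ denotes the number of monic polynomials $g$ of degree $k+1$ over $\mathbb{F}_q$ whose coefficient of $x^k$ equals $\gamma$ and such that exactly $r$ elements $\alpha\in D$ satisfy $(x+\alpha)\mid g$. $\mathbf{1}[P]$ is $1$ if $P$ holds and $0$ otherwise; binomial coefficients with out-of-range lower index are $0$ and empty sums are $0$. *)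

theory Defs
  imports "HOL-Computational_Algebra.Computational_Algebra" "HOL-Library.Cardinality"
begin

definition additive_subgroup :: "'a::ab_group_add set \<Rightarrow> bool" where
  "additive_subgroup D \<longleftrightarrow>
     0 \<in> D \<and> (\<forall>x\<in>D. \<forall>y\<in>D. x + y \<in> D) \<and> (\<forall>x\<in>D. - x \<in> D)"

(* N_count D k \<gamma> r is N(x^(k+1) + \<gamma> x^k, r). The polynomial [:\<alpha>, 1:] is x + \<alpha>, so for each
   g the linear factors counted are those belonging to the roots -\<alpha> with \<alpha> in D. *)
definition N_count :: "'a::{field,finite} set \<Rightarrow> nat \<Rightarrow> 'a \<Rightarrow> nat \<Rightarrow> nat" where
  "N_count D k \<gamma> r =
     card {g :: 'a poly. degree g = k + 1 \<and> lead_coeff g = 1 \<and> coeff g k = \<gamma> \<and>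
                         card {\<alpha> \<in> D. [:\<alpha>, 1:] dvd g} = r}"

(* Integer arguments, so that differences such as k + 1 - r are not truncated and an
   out-of-range lower index gives 0. *)
definition binom :: "int \<Rightarrow> int \<Rightarrow> rat" where
  "binom m j = (if 0 \<le> j \<and> j \<le> m then of_nat (nat m choose nat j) else 0)"

end

theory Submission
  imports Defs
begin

text \<open>
  Inclusion-exclusion over the subsets \<open>S \<subseteq> D\<close> reduces the count to the number of polynomials
  divisible by all \<open>x + \<alpha>\<close>, \<open>\<alpha> \<in> S\<close>. This number is \<open>q ^ (k - |S|)\<close> if \<open>|S| \<le> k\<close>, vanishes if
  \<open>|S| > k + 1\<close>, and for \<open>|S| = k + 1\<close> indicates whether the elements of \<open>S\<close> add up to \<open>\<gamma>\<close>.
  The number \<open>A s c\<close> of \<open>s\<close>-subsets of \<open>D\<close> with sum \<open>c\<close> satisfies the Newton identity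
  \<open>s * A s c = \<Sum>i<s. (-1) ^ i * (\<Sum>d\<in>D. A (s - 1 - i) (c - (i + 1) * d))\<close>, whose inner sum is
  \<open>n * A (s - 1 - i) c\<close> if \<open>p\<close> divides \<open>i + 1\<close> and \<open>n choose (s - 1 - i)\<close> otherwise. Hence the
  excess \<open>A s c - (n choose s) / n\<close> obeys a linear recurrence in steps of \<open>p\<close>, solved by signed
  binomial coefficients of \<open>n / p\<close>.
\<close>

section \<open>Subset sums in an additive subgroup\<close>

lemma additive_subgroup_of_nat_mult:
  fixes D :: "'a::ring_1 set"
  assumes "additive_subgroup D" "d \<in> D"
  shows "of_nat i * d \<in> D"
  using assms by (induction i) (auto simp: additive_subgroup_def algebra_simps)

lemma additive_subgroup_diff:
  assumes "additive_subgroup D" "c \<in> D" "d \<in> D"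
  shows "c - d \<in> D"
  using assms unfolding additive_subgroup_def by (metis diff_conv_add_uminus)

lemma additive_subgroup_sum:
  assumes "additive_subgroup D" "S \<subseteq> D"
  shows "\<Sum>S \<in> D"
proof (cases "finite S")
  case True
  then show ?thesis using assms(2)
    by (induction S) (use assms(1) in \<open>auto simp: additive_subgroup_def\<close>)
qed (use assms in \<open>auto simp: additive_subgroup_def\<close>)

text \<open>This is \<open>A s c\<close> of the introduction. For finite \<open>D\<close> it is the
  coefficient of \<open>z ^ s * e c\<close> in the product of all \<open>1 + z * e d\<close>,
  \<open>d\<close> in \<open>D\<close>, over the group ring with basis elements
  \<open>e d\<close>.\<close>

definition subset_sum_count :: "'a::comm_monoid_add set \<Rightarrow> nat \<Rightarrow> 'a \<Rightarrow> nat" where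
  "subset_sum_count D s c = card {S. S \<subseteq> D \<and> card S = s \<and> \<Sum>S = c}"

lemma subset_sum_count_0:
  assumes "finite D"
  shows "subset_sum_count D 0 c = of_bool (c = 0)"
proof -
  have "{S. S \<subseteq> D \<and> card S = 0 \<and> \<Sum>S = c} = (if c = 0 then {{}} else {})"
    using finite_subset[OF _ assms] by (auto simp: card_eq_0_iff)
  then show ?thesis by (simp add: subset_sum_count_def)
qed

text \<open>By closure under addition every subset sum lies in \<open>D\<close>, so classifying the
  \<open>s\<close>-subsets by their sum loses none.\<close>

lemma sum_subset_sum_count:
  assumes "finite D" "additive_subgroup D"
  shows "(\<Sum>c\<in>D. subset_sum_count D s c) = card D choose s"
proof -
  have "(\<Sum>c\<in>D. \<Sum>S | S \<in> {S. S \<subseteq> D \<and> card S = s} \<and> \<Sum>S = c. 1)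
      = (\<Sum>S | S \<subseteq> D \<and> card S = s. (1::nat))"
    by (rule sum.group) (use assms additive_subgroup_sum in auto)
  then show ?thesis
    using n_subsets[OF assms(1), of s] by (simp add: subset_sum_count_def conj_assoc)
qed

text \<open>Removing \<open>d\<close> matches the \<open>(s + 1)\<close>-subsets containing
  \<open>d\<close> with the \<open>s\<close>-subsets avoiding \<open>d\<close>; together with the
  \<open>s\<close>-subsets containing \<open>d\<close> these are all \<open>s\<close>-subsets of sum
  \<open>c - d\<close>.\<close>

lemma card_subsets_containing:
  fixes c :: "'a::ab_group_add"
  assumes "finite D" "d \<in> D"
  shows "card {S. S \<subseteq> D \<and> d \<in> S \<and> card S = Suc s \<and> \<Sum>S = c}
       + card {S. S \<subseteq> D \<and> d \<in> S \<and> card S = s \<and> \<Sum>S = c - d} = subset_sum_count D s (c - d)"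
proof -
  let ?B = "{S. S \<subseteq> D \<and> d \<notin> S \<and> card S = s \<and> \<Sum>S = c - d}"
  let ?C = "{S. S \<subseteq> D \<and> d \<in> S \<and> card S = s \<and> \<Sum>S = c - d}"
  have fin: "finite S" if "S \<subseteq> D" for S using that assms(1) finite_subset by blast
  have "bij_betw (insert d) ?B {S. S \<subseteq> D \<and> d \<in> S \<and> card S = Suc s \<and> \<Sum>S = c}"
    by (rule bij_betw_byWitness[where f' = "\<lambda>S. S - {d}"])
      (use assms(2) fin in \<open>auto simp: sum_diff1\<close>)
  then have "card {S. S \<subseteq> D \<and> d \<in> S \<and> card S = Suc s \<and> \<Sum>S = c} = card ?B"
    by (simp add: bij_betw_same_card)
  moreover have "card ?B + card ?C = card (?B \<union> ?C)"
    by (subst card_Un_disjoint) (use assms(1) in \<open>auto intro: finite_subset[of _ "Pow D"]\<close>)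
  moreover have "?B \<union> ?C = {S. S \<subseteq> D \<and> card S = s \<and> \<Sum>S = c - d}" by auto
  ultimately show ?thesis by (simp add: subset_sum_count_def)
qed

text \<open>Iterating the previous relation lowers the size by one and the target by
  \<open>d\<close> at each step, with alternating sign. It ends at size 0, where no subset contains
  \<open>d\<close>.\<close>

lemma card_subsets_containing_alternating:
  fixes c :: "'a::comm_ring_1"
  assumes "finite D" "d \<in> D"
  shows "(of_nat (card {S. S \<subseteq> D \<and> d \<in> S \<and> card S = s \<and> \<Sum>S = c}) :: rat)
    = (\<Sum>i<s. (-1) ^ i * of_nat (subset_sum_count D (s - 1 - i) (c - of_nat (Suc i) * d)))"
proof (induction s arbitrary: c)
  case 0
  have "{S. S \<subseteq> D \<and> d \<in> S \<and> card S = 0 \<and> \<Sum>S = c} = {}"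
    using assms finite_subset by fastforce
  then show ?case by (simp only: card.empty of_nat_0 lessThan_0 sum.empty)
next
  case (Suc s)
  have "(of_nat (card {S. S \<subseteq> D \<and> d \<in> S \<and> card S = Suc s \<and> \<Sum>S = c}) :: rat)
      = of_nat (subset_sum_count D s (c - d))
        - of_nat (card {S. S \<subseteq> D \<and> d \<in> S \<and> card S = s \<and> \<Sum>S = c - d})"
    by (subst card_subsets_containing[OF assms, of s c, symmetric]) simp
  also have "\<dots> = (\<Sum>i<Suc s. (-1) ^ i *
      of_nat (subset_sum_count D (Suc s - 1 - i) (c - of_nat (Suc i) * d)))"
    unfolding Suc sum.lessThan_Suc_shift
    by (simp add: sum_negf algebra_simps)
  finally show ?case .
qed

text \<open>Newton's identity between elementary symmetric polynomials and power sums, read in the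
  group ring of \<open>D\<close>.\<close>
lemma subset_sum_count_newton:
  fixes c :: "'a::comm_ring_1"
  assumes "finite D"
  shows "(of_nat s * of_nat (subset_sum_count D s c) :: rat)
    = (\<Sum>i<s. (-1) ^ i *
        (\<Sum>d\<in>D. of_nat (subset_sum_count D (s - 1 - i) (c - of_nat (Suc i) * d))))"
proof -
  let ?A = "{S. S \<subseteq> D \<and> card S = s \<and> \<Sum>S = c}"
  have "s * subset_sum_count D s c = (\<Sum>S\<in>?A. card {d\<in>D. d \<in> S})"
    by (auto simp: subset_sum_count_def Int_absorb1 simp flip: Int_def intro!: sum.cong
        arg_cong[where f = card])
  also have "\<dots> = (\<Sum>d\<in>D. card {S\<in>?A. d \<in> S})"
    by (rule sum_multicount_gen) (use assms in \<open>auto intro: finite_subset[of _ "Pow D"]\<close>)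
  also have "\<dots> = (\<Sum>d\<in>D. card {S. S \<subseteq> D \<and> d \<in> S \<and> card S = s \<and> \<Sum>S = c})"
    by (intro sum.cong refl arg_cong[where f = card]) auto
  finally have "(of_nat (s * subset_sum_count D s c) :: rat)
      = (\<Sum>d\<in>D. of_nat (card {S. S \<subseteq> D \<and> d \<in> S \<and> card S = s \<and> \<Sum>S = c}))"
    by simp
  also have "\<dots> = (\<Sum>d\<in>D. \<Sum>i<s. (-1) ^ i *
      of_nat (subset_sum_count D (s - 1 - i) (c - of_nat (Suc i) * d)))"
    using card_subsets_containing_alternating[OF assms] by (intro sum.cong) auto
  also have "\<dots> = (\<Sum>i<s. (-1) ^ i *
        (\<Sum>d\<in>D. of_nat (subset_sum_count D (s - 1 - i) (c - of_nat (Suc i) * d))))"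
    by (subst sum.swap) (simp add: sum_distrib_left)
  finally show ?thesis by simp
qed

text \<open>This is used with \<open>N = n\<close> and with \<open>N = n / p\<close>. A rational
  \<open>N\<close> is essential for the latter, because \<open>p dvd n\<close> is only derived
  later, from the closed form that relies on this identity.\<close>

lemma gbinomial_alternating_sum:
  fixes N :: rat
  shows "N * (\<Sum>i<u. (-1) ^ i * (N gchoose (u - 1 - i))) = of_nat u * (N gchoose u)"
proof (induction u)
  case (Suc u)
  have "(\<Sum>i<Suc u. (-1) ^ i * (N gchoose (Suc u - 1 - i)))
      = (N gchoose u) - (\<Sum>i<u. (-1) ^ i * (N gchoose (u - 1 - i)))"
    unfolding sum.lessThan_Suc_shift by (simp add: sum_negf)
  then show ?case using Suc gbinomial_mult_1[of N u] by (simp add: right_diff_distrib)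
qed simp

section \<open>Deviation from equidistribution of subset sums: recurrence and solution\<close>

context
  fixes D :: "'a::{field,finite} set" and c :: 'a
  assumes D: "additive_subgroup D" and c: "c \<in> D"
begin

text \<open>If the characteristic divides \<open>i\<close>, the shift \<open>of_nat i * d\<close> is
  0 and all terms agree. Otherwise \<open>d\<close> maps to \<open>c - of_nat i * d\<close> by a
  permutation of \<open>D\<close>, so every target in \<open>D\<close> occurs once.\<close>

lemma sum_subset_sum_count_translates:
  "(\<Sum>d\<in>D. subset_sum_count D s (c - of_nat i * d))
    = (if CHAR('a) dvd i then card D * subset_sum_count D s c else card D choose s)"
proof (cases "CHAR('a) dvd i")
  case True
  then have "of_nat i = (0::'a)" by (simp add: of_nat_eq_0_iff_char_dvd)
  then show ?thesis using True by simp
next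
  case False
  then have i: "of_nat i \<noteq> (0::'a)" by (simp add: of_nat_eq_0_iff_char_dvd)
  let ?f = "\<lambda>d. c - of_nat i * d"
  have inj: "inj_on ?f D" using i by (auto simp: inj_on_def)
  have "?f ` D \<subseteq> D"
    using D c additive_subgroup_diff additive_subgroup_of_nat_mult by blast
  then have "?f ` D = D" using inj by (simp add: endo_inj_surj)
  then have "(\<Sum>d\<in>D. subset_sum_count D s (?f d)) = (\<Sum>d\<in>D. subset_sum_count D s d)"
    using sum.reindex[OF inj, of "subset_sum_count D s"] by simp
  then show ?thesis using False sum_subset_sum_count[OF _ D] by simp
qed

text \<open>The subtracted term is the average of the count over all targets in
  \<open>D\<close>.\<close>

definition excess :: "nat \<Rightarrow> rat" where
  "excess s = of_nat (subset_sum_count D s c) - of_nat (card D choose s) / of_nat (card D)"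

text \<open>The averages satisfy the alternating binomial identity with \<open>N = n\<close>.
  Subtracting it from Newton's identity cancels every term in which the characteristic does not
  divide \<open>i + 1\<close>.\<close>

lemma excess_recurrence:
  "of_nat s * excess s
    = of_nat (card D) * (\<Sum>i | i < s \<and> CHAR('a) dvd Suc i. (-1) ^ i * excess (s - 1 - i))"
proof -
  let ?n = "of_nat (card D) :: rat"
  let ?A = "\<lambda>s. of_nat (subset_sum_count D s c) :: rat"
  let ?C = "\<lambda>s. of_nat (card D choose s) :: rat"
  have n: "?n \<noteq> 0" using c by auto
  have 1: "of_nat s * ?A s = (\<Sum>i<s. (-1) ^ i *
      (if CHAR('a) dvd Suc i then ?n * ?A (s - 1 - i) else ?C (s - 1 - i)))"
    unfolding subset_sum_count_newton[OF finite]
    by (intro sum.cong refl arg_cong2[where f = "(*)"])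
      (simp only: of_nat_sum[symmetric] sum_subset_sum_count_translates, simp)
  have 2: "of_nat s * (?C s / ?n) = (\<Sum>i<s. (-1) ^ i * ?C (s - 1 - i))"
    using gbinomial_alternating_sum[of ?n s] n
    by (simp add: binomial_gbinomial field_simps)
  have "of_nat s * excess s = (\<Sum>i<s. (-1) ^ i *
      (if CHAR('a) dvd Suc i then ?n * ?A (s - 1 - i) else ?C (s - 1 - i))
       - (-1) ^ i * ?C (s - 1 - i))"
    unfolding excess_def right_diff_distrib 1 2 by (simp add: sum_subtractf)
  also have "\<dots> = (\<Sum>i<s. if CHAR('a) dvd Suc i then ?n * ((-1) ^ i * excess (s - 1 - i)) else 0)"
    using n by (intro sum.cong) (auto simp: excess_def field_simps)
  also have "\<dots> = ?n * (\<Sum>i | i < s \<and> CHAR('a) dvd Suc i. (-1) ^ i * excess (s - 1 - i))"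
    by (subst sum.inter_filter[symmetric]) (auto simp: sum_distrib_left lessThan_def)
  finally show ?thesis .
qed

text \<open>Strong induction along the recurrence. Its indices \<open>s - (i + 1)\<close> differ
  from \<open>s\<close> by multiples of the characteristic, so the residue class of 0 decouples from
  the others, in which everything vanishes.\<close>

lemma excess_closed_form:
  "excess s = (if CHAR('a) dvd s
     then excess 0 * (-1) ^ (s + s div CHAR('a))
       * (of_nat (card D) / of_nat CHAR('a) gchoose (s div CHAR('a))) else 0)"
proof (induction s rule: less_induct)
  case (less s)
  let ?p = "CHAR('a)" and ?n = "of_nat (card D) :: rat"
  have p: "?p > 0" by (simp add: finite_imp_CHAR_pos)
  consider "s = 0" | "\<not> ?p dvd s" | u where "s = ?p * u" "s > 0" by (metis dvdE gr0I)
  then show ?case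
  proof cases
    case 2
    have "excess (s - 1 - i) = 0" if "i < s" "?p dvd Suc i" for i
    proof -
      have "\<not> ?p dvd s - Suc i"
        using 2 that by (metis Suc_leI dvd_diffD)
      then show ?thesis using less[of "s - 1 - i"] that by auto
    qed
    then have "of_nat s * excess s = 0" unfolding excess_recurrence by auto
    moreover have "s \<noteq> 0" using 2 by (intro notI) simp
    ultimately show ?thesis using 2 by simp
  next
    case 3
    let ?g = "\<lambda>j. ?n / of_nat ?p gchoose j"
    \<comment> \<open>The indices \<open>i < s\<close> with \<open>i + 1\<close> divisible by the
      characteristic are those with \<open>i + 1 = ?p * (j + 1)\<close>,
      \<open>j < u\<close>.\<close>
    have bij: "bij_betw (\<lambda>j. ?p * Suc j - 1) {..<u} {i. i < s \<and> ?p dvd Suc i}"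
    proof (rule bij_betw_byWitness[where f' = "\<lambda>i. Suc i div ?p - 1"])
      have "?p * Suc j - 1 < s" if "j < u" for j
      proof -
        have "?p * Suc j \<le> ?p * u" using that by (intro mult_le_mono) auto
        moreover have "?p * Suc j > 0" using p by simp
        ultimately show ?thesis using 3 by linarith
      qed
      then show "(\<lambda>j. ?p * Suc j - 1) ` {..<u} \<subseteq> {i. i < s \<and> ?p dvd Suc i}"
        using p by auto
      have "Suc i div ?p - 1 < u" if i: "i < s" "?p dvd Suc i" for i
      proof -
        obtain t where t: "Suc i = ?p * t" using i(2) by (elim dvdE)
        then have "?p * t \<le> ?p * u" using i(1) 3(1) by linarith
        then have "t \<le> u" using p by simp
        moreover have "t > 0" using t by (cases t) auto
        ultimately show ?thesis using t p by simp
      qed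
      then show "(\<lambda>i. Suc i div ?p - 1) ` {i. i < s \<and> ?p dvd Suc i} \<subseteq> {..<u}" by auto
      show "\<forall>j\<in>{..<u}. Suc (?p * Suc j - 1) div ?p - 1 = j"
        using p by simp
      show "\<forall>i\<in>{i. i < s \<and> ?p dvd Suc i}. ?p * Suc (Suc i div ?p - 1) - 1 = i"
      proof
        fix i assume "i \<in> {i. i < s \<and> ?p dvd Suc i}"
        then obtain t where t: "Suc i = ?p * t" by (auto elim: dvdE)
        then obtain t' where "t = Suc t'" by (cases t) auto
        then show "?p * Suc (Suc i div ?p - 1) - 1 = i" using t p
          by (metis diff_Suc_1 less_not_refl nonzero_mult_div_cancel_left)
      qed
    qed
    have "of_nat s * excess s
        = ?n * (\<Sum>j<u. (-1) ^ (?p * Suc j - 1) * excess (s - 1 - (?p * Suc j - 1)))"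
      unfolding excess_recurrence
      by (simp add: sum.reindex_bij_betw[OF bij, symmetric])
    also have "\<dots> = ?n * (\<Sum>j<u. excess 0 * (-1) ^ (s + u) * ((-1) ^ j * ?g (u - 1 - j)))"
    proof (rule arg_cong[where f = "(*) ?n"], rule sum.cong[OF refl])
      fix j assume "j \<in> {..<u}"
      then obtain v where u: "u = Suc j + v" by (auto simp: less_iff_Suc_add)
      have e: "s - 1 - (?p * Suc j - 1) = ?p * v"
        using p 3(1) unfolding u by (simp add: algebra_simps)
      have "?p * v < s" using p 3(1) unfolding u by (simp add: algebra_simps)
      then have "excess (?p * v) = excess 0 * (-1) ^ (?p * v + v) * ?g v"
        using less[of "?p * v"] p by simp
      \<comment> \<open>The two total exponents differ by the even number
        \<open>2 * (j + 1)\<close>.\<close>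
      moreover have "(-1 :: rat) ^ (?p * Suc j - 1) * (-1) ^ (?p * v + v) = (-1) ^ (s + u) * (-1) ^ j"
      proof -
        have "?p * Suc j > 0" using p by simp
        moreover have "s + u + j = ?p * Suc j + ?p * v + v + 2 * j + 1"
          unfolding 3(1) u by (simp add: algebra_simps)
        ultimately have "s + u + j = (?p * Suc j - 1) + (?p * v + v) + 2 * Suc j" by simp
        then show ?thesis unfolding power_add[symmetric] by (simp only: power_add power_mult) simp
      qed
      moreover have "u - 1 - j = v" using u by simp
      ultimately show "(-1) ^ (?p * Suc j - 1) * excess (s - 1 - (?p * Suc j - 1))
          = excess 0 * (-1) ^ (s + u) * ((-1) ^ j * ?g (u - 1 - j))"
        unfolding e by (simp add: mult_ac)
    qed
    \<comment> \<open>Splitting \<open>?n\<close> as \<open>?p * (?n / ?p)\<close> prepares the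
      alternating identity with \<open>N = ?n / ?p\<close>; the factor \<open>u\<close> it produces
      combines with \<open>?p\<close> to \<open>s\<close>.\<close>
    also have "\<dots> = excess 0 * (-1) ^ (s + u) * (of_nat ?p *
        (?n / of_nat ?p * (\<Sum>j<u. (-1) ^ j * ?g (u - 1 - j))))"
      using p by (simp add: sum_distrib_left[symmetric])
    also have "\<dots> = of_nat s * (excess 0 * (-1) ^ (s + u) * ?g u)"
      unfolding gbinomial_alternating_sum using 3 by simp
    finally have "excess s = excess 0 * (-1) ^ (s + u) * ?g u" using 3(2) by simp
    then show ?thesis using 3 p by simp
  qed simp
qed

text \<open>Otherwise the vanishing excess would make the number of \<open>n\<close>-subsets with sum \<open>c\<close> equal to
  \<open>1 / n\<close>; this replaces Lagrange's theorem.\<close>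
lemma char_dvd_card:
  assumes "card D > 1"
  shows "CHAR('a) dvd card D"
proof (rule ccontr)
  assume "\<not> CHAR('a) dvd card D"
  then have "excess (card D) = 0" by (simp add: excess_closed_form)
  moreover have "(of_nat (card D) :: rat) \<noteq> 0" using c by auto
  ultimately have "(of_nat (subset_sum_count D (card D) c * card D) :: rat) = of_nat 1"
    by (simp add: excess_def divide_simps)
  then have "subset_sum_count D (card D) c * card D = 1" by (simp only: of_nat_eq_iff)
  then show False using assms by simp
qed

end

text \<open>For \<open>c\<close> in \<open>D\<close> this is the average plus the closed form of the
  excess, started at \<open>excess D c 0\<close>, which is 1 or 0 minus \<open>1 / n\<close>.
  Outside \<open>D\<close> no subset sum occurs.\<close>

lemma subset_sum_count_formula:
  fixes D :: "'a::{field,finite} set" and c :: 'a and s :: nat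
  defines "n \<equiv> card D" and "p \<equiv> CHAR('a)"
  assumes D: "additive_subgroup D"
  shows "(of_nat (subset_sum_count D s c) :: rat)
    = of_bool (c \<in> D) / of_nat n * of_nat (n choose s)
    + of_bool (p dvd s \<and> c \<in> D) / of_nat n * (of_nat n * of_bool (c = 0) - 1)
      * (-1) ^ (s + s div p) * of_nat (n div p choose (s div p))"
proof (cases "c \<in> D")
  case False
  then have "{S. S \<subseteq> D \<and> card S = s \<and> \<Sum>S = c} = {}"
    using additive_subgroup_sum[OF D] by auto
  then have "subset_sum_count D s c = 0" unfolding subset_sum_count_def by simp
  then show ?thesis using False by simp
next
  case True
  have n: "n > 0" using True by (auto simp: n_def card_gt_0_iff)
  have p: "p > 0" by (simp add: p_def finite_imp_CHAR_pos)
  have e0: "excess D c 0 = (of_nat n * of_bool (c = 0) - 1) / of_nat n"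
    unfolding excess_def[OF D True]
    using n by (simp add: n_def[symmetric] subset_sum_count_0 field_simps)
  have "excess D c 0 * (of_nat n / of_nat p gchoose (s div p))
      = excess D c 0 * of_nat (n div p choose (s div p))"
  \<comment> \<open>For \<open>n = 1\<close> the quotient \<open>n / p\<close> is not an integer and
    the two binomials may differ, but then \<open>D\<close> and \<open>c\<close> are trivial and the
    factor \<open>excess D c 0\<close> is 0.\<close>
  proof (cases "n = 1")
    case True
    then obtain d where "D = {d}" unfolding n_def by (auto simp: card_1_singleton_iff)
    moreover have "0 \<in> D" using D by (simp add: additive_subgroup_def)
    ultimately have "c = 0" using \<open>c \<in> D\<close> by auto
    then show ?thesis using True e0 by simp
  next
    case False
    then have "p dvd n" using char_dvd_card[OF D True] n by (simp add: n_def p_def)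
    then have "(of_nat n / of_nat p :: rat) = of_nat (n div p)" using p by (auto elim!: dvdE)
    then show ?thesis by (simp add: binomial_gbinomial)
  qed
  moreover have "(of_nat (subset_sum_count D s c) :: rat)
      = excess D c s + of_nat (n choose s) / of_nat n"
    by (simp add: excess_def[OF D True] n_def)
  ultimately show ?thesis
    using excess_closed_form[OF D True, of s] True e0 by (simp add: n_def p_def mult_ac)
qed

text \<open>Translation by 1 permutes the field, so summing all elements gives
  \<open>of_nat (p ^ m) = 0\<close>, hence \<open>of_nat p = 0\<close>.\<close>

lemma CHAR_eq_prime_of_CARD:
  assumes "prime p" "CARD('a::{field,finite}) = p ^ m"
  shows "CHAR('a) = p"
proof -
  have "(\<Sum>x\<in>UNIV. x + 1) = (\<Sum>x\<in>UNIV. x :: 'a)"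
    by (rule sum.reindex_bij_betw) (auto intro: bij_betw_byWitness[where f' = "\<lambda>x. x - 1"])
  then have "of_nat (CARD('a)) = (0::'a)" by (simp add: sum.distrib)
  then have "of_nat p = (0::'a)" using assms(2) by simp
  then have "CHAR('a) dvd p" by (simp add: of_nat_eq_0_iff_char_dvd)
  then show ?thesis using assms(1) CHAR_not_1' by (metis One_nat_def prime_nat_iff)
qed

section \<open>Monic polynomials with prescribed linear factors\<close>

lemma coeff_mult_at_degree_bounds:
  assumes "degree P \<le> s" "degree v \<le> d"
  shows "coeff (P * v) (s + d) = coeff P s * coeff v d"
proof -
  have "coeff P i * coeff v (s + d - i) = 0" if "i \<noteq> s" for i
  proof (cases "i < s")
    case True
    then have "degree v < s + d - i" using assms by linarith
    then show ?thesis by (simp add: coeff_eq_0)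
  next
    case False
    then have "degree P < i" using assms that by linarith
    then show ?thesis by (simp add: coeff_eq_0)
  qed
  then have "(\<Sum>i\<le>s + d. coeff P i * coeff v (s + d - i))
      = (\<Sum>i\<in>{s}. coeff P i * coeff v (s + d - i))"
    by (intro sum.mono_neutral_right) auto
  then show ?thesis by (simp add: coeff_mult)
qed

text \<open>Bounding coefficients rather than the degree leaves only the zero polynomial at
  \<open>d = 0\<close>. The induction splits off the constant coefficient.\<close>

lemma card_bounded_polys:
  "finite {u::'a::{comm_ring_1,finite} poly. \<forall>i\<ge>d. coeff u i = 0} \<and>
   card {u::'a poly. \<forall>i\<ge>d. coeff u i = 0} = CARD('a) ^ d"
proof (induction d)
  case 0
  have "{u::'a poly. \<forall>i\<ge>0. coeff u i = 0} = {0}" by (auto simp: poly_eq_iff)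
  then show ?case by simp
next
  case (Suc d)
  let ?U = "\<lambda>d. {u::'a poly. \<forall>i\<ge>d. coeff u i = 0}"
  have "?U (Suc d) = case_prod pCons ` (UNIV \<times> ?U d)"
  proof (intro equalityI subsetI)
    fix u assume u: "u \<in> ?U (Suc d)"
    obtain a v where uv: "u = pCons a v" by (cases u)
    have "coeff v i = 0" if "i \<ge> d" for i
      using u that unfolding uv by (auto dest!: spec[of _ "Suc i"])
    then show "u \<in> case_prod pCons ` (UNIV \<times> ?U d)" using uv by force
  qed (auto simp: coeff_pCons split: nat.splits)
  moreover have "inj_on (case_prod pCons) (UNIV \<times> ?U d)" by (auto simp: inj_on_def)
  ultimately show ?case using Suc by (simp add: card_image card_cartesian_product)
qed

abbreviation monic_with_subleading :: "nat \<Rightarrow> 'a::comm_ring_1 \<Rightarrow> 'a poly set" where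
  "monic_with_subleading k c \<equiv> {g. degree g = k + 1 \<and> lead_coeff g = 1 \<and> coeff g k = c}"

text \<open>The cofactor of \<open>P\<close> is monic of degree \<open>k + 1 - degree P\<close>. The
  prescribed \<open>c\<close> fixes its subleading coefficient, and the remaining
  \<open>k - degree P\<close> coefficients are free.\<close>

lemma card_monic_multiples:
  fixes P :: "'a::{field,finite} poly"
  assumes P: "lead_coeff P = 1" "degree P \<le> k"
  shows "card {g \<in> monic_with_subleading k c. P dvd g} = CARD('a) ^ (k - degree P)"
proof -
  define s where "s = degree P"
  define d where "d = k - s"
  \<comment> \<open>The subleading coefficient forced on the cofactor: since \<open>P\<close> is
    monic, the term \<open>monom b d\<close> contributes exactly \<open>b\<close> to the coefficient
    of \<open>x ^ k\<close>.\<close>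
  define b where "b = c - coeff (P * monom 1 (d + 1)) k"
  have k: "k = s + d" using P by (simp add: s_def d_def)
  have P0: "P \<noteq> 0" using P by auto
  let ?U = "{u::'a poly. \<forall>i\<ge>d. coeff u i = 0}"
  define h where "h u = monom 1 (d + 1) + (monom b d + u)" for u
  have low: "coeff (P * v) k = coeff v d" if "degree v \<le> d" for v
    using coeff_mult_at_degree_bounds[of P s v d] that P by (simp add: k s_def)
  have "{g \<in> monic_with_subleading k c. P dvd g} = (\<lambda>u. P * h u) ` ?U"
  proof (intro equalityI subsetI)
    fix g assume "g \<in> {g \<in> monic_with_subleading k c. P dvd g}"
    then obtain f where g: "degree g = k + 1" "lead_coeff g = 1" "coeff g k = c" "g = P * f"
      by (auto elim: dvdE)
    have f0: "f \<noteq> 0" using g by auto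
    have degf: "degree f = d + 1"
      using g(1) degree_mult_eq[OF P0 f0] unfolding g(4) by (simp add: k s_def)
    have lf: "coeff f (d + 1) = 1"
      using g(2) P(1) degf unfolding g(4) by (simp add: lead_coeff_mult)
    let ?v = "f - monom 1 (d + 1)"
    have v: "coeff ?v i = 0" if "i > d" for i
      using that lf degf by (cases "i = d + 1") (auto simp: coeff_eq_0)
    then have "degree ?v \<le> d" by (intro degree_le) auto
    then have "coeff ?v d = coeff (P * ?v) k" by (simp add: low)
    also have "\<dots> = b" using g(3,4) by (simp add: b_def right_diff_distrib)
    finally have "coeff ?v d = b" .
    then have "?v - monom b d \<in> ?U" using v by (auto simp: le_less simp del: coeff_diff coeff_monom)
        (auto simp: le_less coeff_diff)
    moreover have "g = P * h (?v - monom b d)" using g(4) by (simp add: h_def)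
    ultimately show "g \<in> (\<lambda>u. P * h u) ` ?U" by blast
  next
    fix g assume "g \<in> (\<lambda>u. P * h u) ` ?U"
    then obtain u where u: "u \<in> ?U" and g: "g = P * h u" by blast
    let ?v = "monom b d + u"
    have "coeff ?v i = 0" if "i > d" for i using that u by auto
    then have dv: "degree ?v \<le> d" by (intro degree_le) auto
    have dh: "degree (h u) = d + 1"
      unfolding h_def using dv by (subst degree_add_eq_left) (auto simp: degree_monom_eq)
    have lh: "coeff (h u) (d + 1) = 1" using u by (simp add: h_def)
    have "h u \<noteq> 0" using dh by auto
    then have dg: "degree g = k + 1" using dh P0 by (simp add: g degree_mult_eq k s_def)
    have lg: "lead_coeff g = 1" using P(1) lh dh by (simp add: g lead_coeff_mult)
    have "coeff g k = coeff (P * monom 1 (d + 1)) k + coeff ?v d"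
      unfolding g h_def distrib_left[of P "monom 1 (d+1)"] coeff_add low[OF dv] ..
    also have "coeff ?v d = b" using u by simp
    finally have "coeff g k = c" by (simp add: b_def)
    then show "g \<in> {g \<in> monic_with_subleading k c. P dvd g}" using dg lg by (simp add: g)
  qed
  moreover have "inj_on (\<lambda>u. P * h u) ?U" using P0 by (auto simp: inj_on_def h_def)
  ultimately show ?thesis using card_bounded_polys[where 'a = 'a, of d]
    by (simp add: card_image s_def d_def)
qed

lemma monic_same_degree_dvd_eq:
  fixes P :: "'a::field poly"
  assumes "P dvd g" "degree P = degree g" "lead_coeff P = 1" "lead_coeff g = 1"
  shows "g = P"
proof -
  obtain f where f: "g = P * f" using assms(1) by (elim dvdE)
  have "P \<noteq> 0" "f \<noteq> 0" using f assms by auto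
  then have "degree f = 0" using f assms(2) by (simp add: degree_mult_eq)
  then obtain a where "f = [:a:]" by (elim degree_eq_zeroE)
  then show ?thesis using f assms by (simp add: lead_coeff_mult)
qed

abbreviation linear_prod :: "'a::comm_ring_1 set \<Rightarrow> 'a poly" where
  "linear_prod S \<equiv> \<Prod>\<alpha>\<in>S. [:\<alpha>, 1:]"

lemma degree_linear_prod:
  fixes S :: "'a::field set"
  shows "degree (linear_prod S) = card S"
  by (subst degree_prod_eq_sum_degree) auto

lemma lead_coeff_linear_prod:
  fixes S :: "'a::field set"
  shows "lead_coeff (linear_prod S) = 1"
  by (simp add: lead_coeff_prod)

lemma coeff_linear_prod_subleading:
  fixes S :: "'a::field set"
  assumes "finite S" "card S = Suc k"
  shows "coeff (linear_prod S) k = \<Sum>S"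
  using assms
proof (induction S arbitrary: k)
  case (insert a S)
  have "coeff (linear_prod S) (card S) = 1"
    using lead_coeff_linear_prod[of S] degree_linear_prod[of S] by simp
  moreover have "k = card S" using insert by simp
  moreover have "coeff (pCons 0 (linear_prod S)) (card S) = \<Sum>S"
    using insert by (cases "card S") auto
  ultimately show ?case using insert by simp
qed simp

text \<open>The factors for distinct elements are coprime: for \<open>a\<close> outside
  \<open>S\<close>, \<open>- a\<close> is no root of \<open>linear_prod S\<close>, so a root of
  \<open>g\<close> at \<open>- a\<close> passes to the cofactor.\<close>

lemma linear_prod_dvd_iff:
  fixes S :: "'a::field set"
  assumes "finite S"
  shows "linear_prod S dvd g \<longleftrightarrow> (\<forall>\<alpha>\<in>S. [:\<alpha>, 1:] dvd g)"
  using assms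
proof (induction S)
  case (insert a S)
  have root: "[:a, 1:] dvd f \<longleftrightarrow> poly f (- a) = 0" for f
    by (simp add: poly_eq_0_iff_dvd)
  have "poly (linear_prod S) (- a) \<noteq> 0"
    using insert by (auto simp: poly_prod)
  then have "[:a, 1:] * linear_prod S dvd g \<longleftrightarrow> [:a, 1:] dvd g \<and> linear_prod S dvd g"
  proof (intro iffI conjI)
    assume "[:a, 1:] dvd g \<and> linear_prod S dvd g"
    then have g: "poly g (- a) = 0" and "linear_prod S dvd g" by (auto simp: root)
    from this(2) obtain f where f: "g = linear_prod S * f" by (elim dvdE)
    assume "poly (linear_prod S) (- a) \<noteq> 0"
    then have "[:a, 1:] dvd f" using f g by (simp add: root)
    then show "[:a, 1:] * linear_prod S dvd g" unfolding f by (subst mult.commute) (rule mult_dvd_mono, simp_all)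
  qed (blast dest: dvd_mult_left dvd_mult_right)+
  then show ?case using insert by simp
qed simp

text \<open>Subset sums enter here: for \<open>card S = k + 1\<close> the only candidate is
  \<open>linear_prod S\<close> itself, whose coefficient of \<open>x ^ k\<close> is the sum of
  \<open>S\<close>.\<close>

lemma card_monic_linear_multiples:
  fixes S :: "'a::{field,finite} set"
  shows "card {g \<in> monic_with_subleading k c. \<forall>\<alpha>\<in>S. [:\<alpha>, 1:] dvd g}
    = (if card S \<le> k then CARD('a) ^ (k - card S)
       else of_bool (card S = k + 1 \<and> \<Sum>S = c))"
proof -
  let ?G = "{g \<in> monic_with_subleading k c. linear_prod S dvd g}"
  have "card ?G = (if card S \<le> k then CARD('a) ^ (k - card S)
       else of_bool (card S = k + 1 \<and> \<Sum>S = c))"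
  proof (cases "card S \<le> k")
    case True
    then show ?thesis
      using card_monic_multiples[OF lead_coeff_linear_prod, of S k c]
      by (simp add: degree_linear_prod)
  next
    case False
    have "?G = (if card S = k + 1 \<and> \<Sum>S = c then {linear_prod S} else {})"
    proof (cases "card S = k + 1")
      case True
      then have sub: "g = linear_prod S" if "g \<in> ?G" for g
        using that by (intro monic_same_degree_dvd_eq lead_coeff_linear_prod)
          (auto simp: degree_linear_prod)
      have "coeff (linear_prod S) k = \<Sum>S"
        using True by (intro coeff_linear_prod_subleading) auto
      then have "linear_prod S \<in> ?G \<longleftrightarrow> \<Sum>S = c"
        using True degree_linear_prod[of S] lead_coeff_linear_prod[of S] by simp
      then have G: "?G = {g. g = linear_prod S \<and> \<Sum>S = c}" using sub by blast
      show ?thesis unfolding G using True by auto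
    next
      case False
      have "\<not> linear_prod S dvd g" if "g \<in> monic_with_subleading k c" for g
      proof
        assume "linear_prod S dvd g"
        moreover have "g \<noteq> 0" using that by auto
        ultimately have "card S \<le> degree g"
          using dvd_imp_degree_le degree_linear_prod[of S] by metis
        then show False using that False \<open>\<not> card S \<le> k\<close> by simp
      qed
      then show ?thesis using False by auto
    qed
    then show ?thesis using False by simp
  qed
  then show ?thesis by (simp add: linear_prod_dvd_iff)
qed

text \<open>The weights \<open>(-1) ^ (s + r) * (s choose r)\<close> invert the relation counting \<open>s\<close>-subsets of
  the set of linear factors.\<close>
lemma indicator_card_eq_sum_subsets:
  assumes "finite R"
  shows "(\<Sum>S\<in>Pow R. (-1) ^ (card S + r) * of_nat (card S choose r)) = (of_bool (card R = r) :: rat)"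
proof -
  let ?n = "card R"
  have "(\<Sum>S\<in>Pow R. (-1) ^ (card S + r) * of_nat (card S choose r) :: rat)
     = (\<Sum>s\<le>?n. \<Sum>S | S \<in> Pow R \<and> card S = s. (-1) ^ (card S + r) * of_nat (card S choose r))"
    using assms by (intro sum.group[symmetric]) (auto intro: card_mono)
  also have "\<dots> = (\<Sum>s\<le>?n. of_nat (?n choose s) * ((-1) ^ (s + r) * of_nat (s choose r)))"
    by (intro sum.cong refl) (simp add: n_subsets[OF assms])
  also have "\<dots> = of_bool (?n = r)"
  proof (cases "r \<le> ?n")
    case False
    then show ?thesis by (intro sum.neutral[THEN trans]) auto
  next
    case True
    have "(\<Sum>s\<le>?n. of_nat (?n choose s) * ((-1) ^ (s + r) * of_nat (s choose r)) :: rat)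
      = (\<Sum>s=r..?n. of_nat (?n choose s) * ((-1) ^ (s + r) * of_nat (s choose r)))"
      by (intro sum.mono_neutral_right) auto
    also have "\<dots> = (\<Sum>j\<le>?n - r. of_nat (?n choose (j + r)) * ((-1) ^ (j + r + r) * of_nat (j + r choose r)))"
      by (rule sum.reindex_bij_witness[of _ "\<lambda>j. j + r" "\<lambda>s. s - r"]) (use True in auto)
    \<comment> \<open>Trinomial revision leaves the alternating sum over row \<open>?n - r\<close>,
      which vanishes unless that row is row 0.\<close>
    also have "\<dots> = (\<Sum>j\<le>?n - r. of_nat (?n choose r) * ((-1) ^ j * of_nat (?n - r choose j)))"
    proof (rule sum.cong[OF refl])
      fix j assume "j \<in> {..?n - r}"
      then have "(?n choose (j + r)) * (j + r choose r) = (?n choose r) * (?n - r choose j)"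
        using choose_mult[of r "j + r" ?n] True by simp
      then show "(of_nat (?n choose (j + r)) * ((-1) ^ (j + r + r) * of_nat (j + r choose r)) :: rat)
        = of_nat (?n choose r) * ((-1) ^ j * of_nat (?n - r choose j))"
        by (simp add: power_add mult_ac flip: of_nat_mult power_mult_distrib)
    qed
    also have "\<dots> = of_nat (?n choose r) * (\<Sum>j\<le>?n - r. (-1) ^ j * of_nat (?n - r choose j))"
      by (simp add: sum_distrib_left)
    also have "\<dots> = of_bool (?n = r)"
      using True choose_alternating_sum[of "?n - r", where 'a = rat] by (cases "?n = r") auto
    finally show ?thesis .
  qed
  finally show ?thesis .
qed

section \<open>Inclusion-exclusion\<close>

text \<open>The indicator of exactly \<open>r\<close> linear factors is expanded into weights over
  subsets; exchanging the sums leaves counts of common multiples, which for sizes up to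
  \<open>k\<close> depend on the size alone.\<close>

lemma N_count_eq_sum:
  fixes D :: "'a::{field,finite} set"
  shows "(of_nat (N_count D k c r) :: rat) =
      (\<Sum>s\<le>k. (-1) ^ (s + r) * of_nat (s choose r) * of_nat (card D choose s) * of_nat (CARD('a)) ^ (k - s))
    + (-1) ^ (k + 1 + r) * of_nat (k + 1 choose r) * of_nat (subset_sum_count D (k + 1) c)"
proof -
  let ?G = "monic_with_subleading k c"
  define w where "w s = ((-1) ^ (s + r) * of_nat (s choose r) :: rat)" for s
  define R where "R g = {\<alpha> \<in> D. [:\<alpha>, 1:] dvd g}" for g
  define M where "M S = card {g \<in> ?G. \<forall>\<alpha>\<in>S. [:\<alpha>, 1:] dvd g}" for S :: "'a set"
  have M_eq: "M S = (if card S \<le> k then CARD('a) ^ (k - card S)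
      else of_bool (card S = k + 1 \<and> \<Sum>S = c))" for S
    unfolding M_def by (rule card_monic_linear_multiples)
  have finG: "finite ?G"
  proof (rule finite_subset)
    show "?G \<subseteq> {u. \<forall>i\<ge>k + 2. coeff u i = 0}" by (auto simp: coeff_eq_0)
  qed (use card_bounded_polys in blast)
  have "of_nat (N_count D k c r) = (\<Sum>g\<in>?G. of_bool (card (R g) = r) :: rat)"
  proof -
    have "{g. degree g = k + 1 \<and> lead_coeff g = 1 \<and> coeff g k = c \<and> card (R g) = r}
        = {g \<in> ?G. card (R g) = r}" by auto
    then show ?thesis using finG
      by (simp add: N_count_def R_def[symmetric] of_bool_def sum.If_cases Int_def)
  qed
  also have "\<dots> = (\<Sum>g\<in>?G. \<Sum>S\<in>Pow (R g). w (card S))"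
    by (intro sum.cong refl) (simp only: w_def indicator_card_eq_sum_subsets finite)
  also have "\<dots> = (\<Sum>g\<in>?G. \<Sum>S\<in>Pow D. if \<forall>\<alpha>\<in>S. [:\<alpha>, 1:] dvd g then w (card S) else 0)"
  proof (rule sum.cong[OF refl])
    fix g
    have "Pow (R g) = {S \<in> Pow D. \<forall>\<alpha>\<in>S. [:\<alpha>, 1:] dvd g}" by (auto simp: R_def)
    then show "(\<Sum>S\<in>Pow (R g). w (card S))
        = (\<Sum>S\<in>Pow D. if \<forall>\<alpha>\<in>S. [:\<alpha>, 1:] dvd g then w (card S) else 0)"
      by (simp only: sum.inter_filter finite)
  qed
  also have "\<dots> = (\<Sum>S\<in>Pow D. \<Sum>g\<in>?G. if \<forall>\<alpha>\<in>S. [:\<alpha>, 1:] dvd g then w (card S) else 0)"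
    by (rule sum.swap)
  also have "\<dots> = (\<Sum>S\<in>Pow D. w (card S) * of_nat (M S))"
    by (intro sum.cong refl) (simp only: M_def sum.inter_filter[OF finG, symmetric] sum_constant mult.commute)
  \<comment> \<open>The bound exceeds every subset size and is at least \<open>k + 1\<close>, so the
    range can afterwards be cut to \<open>k + 1\<close>, beyond which \<open>M S\<close> is
    0.\<close>
  also have "\<dots> = (\<Sum>s\<le>card D + k + 1. \<Sum>S | S \<in> Pow D \<and> card S = s. w (card S) * of_nat (M S))"
    by (intro sum.group[symmetric]) (auto intro: le_trans[OF card_mono])
  also have "\<dots> = (\<Sum>s\<le>card D + k + 1. w s * (\<Sum>S | S \<subseteq> D \<and> card S = s. of_nat (M S)))"
    by (intro sum.cong refl) (simp add: sum_distrib_left)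
  also have "\<dots> = (\<Sum>s\<le>k + 1. w s * (\<Sum>S | S \<subseteq> D \<and> card S = s. of_nat (M S)))"
    by (intro sum.mono_neutral_right) (auto simp: M_eq intro!: sum.neutral)
  also have "\<dots> = (\<Sum>s\<le>k. w s * (\<Sum>S | S \<subseteq> D \<and> card S = s. of_nat (M S)))
      + w (k + 1) * (\<Sum>S | S \<subseteq> D \<and> card S = k + 1. of_nat (M S))"
    by simp
  also have "(\<Sum>S | S \<subseteq> D \<and> card S = k + 1. of_nat (M S) :: rat) = of_nat (subset_sum_count D (k + 1) c)"
  proof -
    have "(\<Sum>S | S \<subseteq> D \<and> card S = k + 1. M S)
        = (\<Sum>S | S \<subseteq> D \<and> card S = k + 1. if \<Sum>S = c then 1 else 0)"
      by (intro sum.cong) (auto simp: M_eq)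
    also have "\<dots> = subset_sum_count D (k + 1) c"
      by (simp add: sum.inter_filter[symmetric] subset_sum_count_def conj_assoc)
    finally show ?thesis by (simp only: of_nat_sum[symmetric])
  qed
  also have "(\<Sum>s\<le>k. w s * (\<Sum>S | S \<subseteq> D \<and> card S = s. of_nat (M S)))
      = (\<Sum>s\<le>k. w s * of_nat (card D choose s) * of_nat (CARD('a)) ^ (k - s))"
  proof (rule sum.cong[OF refl])
    fix s assume "s \<in> {..k}"
    then have "(\<Sum>S | S \<subseteq> D \<and> card S = s. of_nat (M S) :: rat)
        = (\<Sum>S | S \<subseteq> D \<and> card S = s. of_nat (CARD('a)) ^ (k - s))"
      by (intro sum.cong) (auto simp: M_eq)
    then show "w s * (\<Sum>S | S \<subseteq> D \<and> card S = s. of_nat (M S))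
        = w s * of_nat (card D choose s) * of_nat (CARD('a)) ^ (k - s)"
      by (simp add: n_subsets)
  qed
  finally show ?thesis by (simp only: w_def)
qed

section \<open>Passage to binomials and powers with integer arguments\<close>

lemma binom_of_nat: "binom (int a) (int b) = of_nat (a choose b)"
  by (auto simp: binom_def binomial_eq_0)

text \<open>Trinomial revision; with integer arguments both sides vanish outside
  \<open>r \<le> s \<le> n\<close>.\<close>

lemma binomial_product_rat:
  "of_nat (s choose r) * of_nat (n choose s) = binom (int n) (int r) * binom (int n - int r) (int s - int r)"
proof (cases "r \<le> s \<and> s \<le> n")
  case True
  then have "(n choose s) * (s choose r) = (n choose r) * (n - r choose (s - r))"
    by (intro choose_mult) auto
  then have "(of_nat ((s choose r) * (n choose s)) :: rat) = of_nat ((n choose r) * (n - r choose (s - r)))"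
    by (simp only: mult.commute)
  moreover have "binom (int n - int r) (int s - int r) = of_nat (n - r choose (s - r))"
    using True binom_of_nat[of "n - r" "s - r"] by (simp add: of_nat_diff)
  ultimately show ?thesis by (simp add: binom_of_nat)
next
  case False
  then show ?thesis by (auto simp: binom_def binomial_eq_0)
qed

text \<open>Substituting \<open>j = s - r\<close> turns the sum into the first term of the theorem.
  For \<open>r > k\<close> both sides are 0.\<close>

lemma alternating_binomial_sum_reindex:
  assumes "q > 0"
  shows "(\<Sum>s\<le>k. (-1) ^ (s + r) * of_nat (s choose r) * of_nat (n choose s) * of_nat q ^ (k - s) :: rat)
    = of_nat q powi (int k - int r) * binom (int n) (int r) *
        (\<Sum>j = 0..int k - int r. (- of_nat q) powi (- j) * binom (int n - int r) j)"
proof -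
  let ?q = "of_nat q :: rat"
  have "(\<Sum>s\<le>k. (-1) ^ (s + r) * of_nat (s choose r) * of_nat (n choose s) * ?q ^ (k - s))
     = (\<Sum>s=r..k. (-1) ^ (s + r) * of_nat (s choose r) * of_nat (n choose s) * ?q ^ (k - s))"
    by (intro sum.mono_neutral_right) auto
  also have "\<dots> = (\<Sum>j = 0..int k - int r. ?q powi (int k - int r) * binom (int n) (int r) *
        ((- ?q) powi (- j) * binom (int n - int r) j))"
  proof (rule sum.reindex_bij_witness[of _ "\<lambda>j. nat j + r" "\<lambda>s. int s - int r"])
    fix s assume s: "s \<in> {r..k}"
    have "(- ?q) powi (- (int s - int r)) = (-1) ^ (s - r) * inverse (?q ^ (s - r))"
    proof -
      have "- (int s - int r) = - int (s - r)" using s by simp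
      then show ?thesis
        by (simp only: power_int_minus power_int_of_nat power_minus[of ?q] inverse_mult_distrib)
          (simp add: power_inverse[symmetric])
    qed
    moreover have "?q powi (int k - int r) = ?q ^ (k - s) * ?q ^ (s - r)"
    proof -
      have "int k - int r = int ((k - s) + (s - r))" using s by auto
      then show ?thesis by (simp only: power_int_of_nat power_add)
    qed
    moreover have "(-1 :: rat) ^ (s + r) = (-1) ^ (s - r)"
    proof -
      have "s + r = (s - r) + 2 * r" using s by auto
      then show ?thesis by (simp only: power_add power_mult) simp
    qed
    moreover have "?q ^ (s - r) \<noteq> 0" using assms by simp
    ultimately show "?q powi (int k - int r) * binom (int n) (int r) *
        ((- ?q) powi (- (int s - int r)) * binom (int n - int r) (int s - int r))
       = (-1) ^ (s + r) * of_nat (s choose r) * of_nat (n choose s) * ?q ^ (k - s)"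
      using binomial_product_rat[of s r n] by (simp add: mult.assoc)
  qed auto
  finally show ?thesis by (simp add: sum_distrib_left)
qed

theorem theorem2:
  fixes p q m n k r :: nat and D :: "'a::{field,finite} set" and \<gamma> :: 'a
  assumes "prime p" and "q = p ^ m" and "CARD('a) = q"
    and "additive_subgroup D" and "card D = n"
  shows "of_nat (N_count D k \<gamma> r) =
      (of_nat q :: rat) powi (int k - int r) * binom (int n) (int r) *
        (\<Sum>j = 0..int k - int r. (- of_nat q) powi (- j) * binom (int n - int r) j)
    + of_bool (\<gamma> \<in> D) / of_nat n * (- 1) powi (int k + 1 - int r) *
        binom (int n) (int r) * binom (int n - int r) (int k + 1 - int r)
    + of_bool (p dvd k + 1 \<and> \<gamma> \<in> D) / of_nat n * (of_nat n * of_bool (\<gamma> = 0) - 1) *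
        (- 1) ^ (r + (k + 1) div p) *
        binom (int k + 1) (int r) * binom (int (n div p)) (int ((k + 1) div p))"
proof -
  have p: "CHAR('a) = p" using CHAR_eq_prime_of_CARD[of p m] assms by simp
  have q: "q > 0" using assms(1,2) by (simp add: prime_gt_0_nat)
  let ?s = "k + 1"
  \<comment> \<open>For \<open>r > k + 1\<close> the exponent on the right is negative; only its
    parity matters.\<close>
  have sign: "(-1 :: rat) ^ (?s + r) = (-1) powi (int k + 1 - int r)"
  proof (cases "r \<le> ?s")
    case True
    then have "?s + r = (?s - r) + 2 * r" "int k + 1 - int r = int (?s - r)" by auto
    then show ?thesis by (simp only: power_add power_mult power_int_of_nat) simp
  next
    case False
    then have "?s + r = (r - ?s) + 2 * ?s" "int k + 1 - int r = - int (r - ?s)" by auto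
    then show ?thesis
      by (simp only: power_add power_mult power_int_minus power_int_of_nat)
        (simp add: power_inverse[symmetric])
  qed
  have sign2: "(-1 :: rat) ^ (?s + r) * (-1) ^ (?s + ?s div p) = (-1) ^ (r + ?s div p)"
  proof -
    have "?s + r + (?s + ?s div p) = (r + ?s div p) + 2 * ?s" by simp
    then show ?thesis by (simp only: power_add[symmetric]) (simp only: power_add power_mult, simp)
  qed
  have b: "binom (int k + 1) (int r) = of_nat (?s choose r)"
    using binom_of_nat[of ?s r] by (simp add: add.commute)
  have prod: "(of_nat (?s choose r) * of_nat (n choose ?s) :: rat)
      = binom (int n) (int r) * binom (int n - int r) (int k + 1 - int r)"
    using binomial_product_rat[of ?s r n] by (simp add: add.commute)
  let ?E = "of_bool (p dvd ?s \<and> \<gamma> \<in> D) / of_nat n * (of_nat n * of_bool (\<gamma> = 0) - 1) :: rat"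
  have "(-1) ^ (?s + r) * of_nat (?s choose r) * of_nat (subset_sum_count D ?s \<gamma>)
      = of_bool (\<gamma> \<in> D) / of_nat n * (-1) ^ (?s + r) * (of_nat (?s choose r) * of_nat (n choose ?s))
      + ?E * ((-1 :: rat) ^ (?s + r) * (-1) ^ (?s + ?s div p)) * of_nat (?s choose r)
         * of_nat (n div p choose (?s div p))"
    unfolding subset_sum_count_formula[OF assms(4)] p assms(5) distrib_left
    by (simp only: mult_ac times_divide_eq_left times_divide_eq_right)
  then show ?thesis
    unfolding N_count_eq_sum assms(3,5) alternating_binomial_sum_reindex[OF q]
    unfolding sign2 prod unfolding sign b binom_of_nat
    by (simp only: mult.assoc add.assoc)
qed

end
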